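(* Let $(\mathcal{G}_N)_{N\in\mathbb{N}}$ be a dynamic network model that satisfies Assumption $\mathrm{CM}(\gamma)$ for some $\gamma$ satisfying $\frac12<\gamma<1$. Then, for random vertices $V$ and $W$ chosen independently and uniformly from $[N]$, we have $$d_N(V,W)\ \ge\ 2\,\frac{\log\log N}{\log\big(\frac{\gamma}{1-\gamma}\big)}+\mathcal{O}(1),\qquad\text{with high probability as } N\to\infty.$$
   Context: $[N]=\{1,2,\dots,N\}$. A (dynamic) network model is a sequence of random graphs $(\mathcal{G}_N)_{N\in\mathbb{N}}$ where $\mathcal{G}_N$ has vertex set $[N]$ and its set of unoriented edges is a random symmetric subset of $[N]\times[N]$ (multiple edges between the same pair of vertices are occasionally allowed, but have no bearing on distances). Write $v\leftrightarrow w$ if the vertices $v,w$ are connected by an edge in $\mathcal{G}_N$; $v_0\leftrightarrow v_1\leftrightarrow\cdots\leftrightarrow v_\ell$ means that $v_{k-1}\leftrightarrow v_k$ for all $1\le k\le\ell$. The graph distance is $d_N(v,w)=\min\{n: \exists\, v=v_0,v_1,\dots,v_n=w\in\mathcal{G}_N \text{ such that } v_{i-1}\leftrightarrow v_i \text{ for all } 1\le i\le n\}$. Assumption $\mathrm{CM}(\gamma)$: there exists $\kappa$ such that, for all $N$ and pairwise distinct vertices $v_0,\dots,v_\ell\in[N]$, $$\mathbb{P}\big\{v_0\leftrightarrow v_1\leftrightarrow v_2\leftrightarrow\cdots\leftrightarrow v_\ell\big\}\le \prod_{k=1}^{\ell}\kappa\,v_{k-1}^{-\gamma}\,v_k^{-\gamma}\,N^{2\gamma-1}.$$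 "With high probability" means with probability tending to $1$ as $N\to\infty$.
   Formalization: The O(1) is bounded in probability: for each ε>0 there is a constant C, which may depend on ε, such that the bound minus C holds with probability at least 1−ε for all large N; a single deterministic O(1) with probability tending to 1 is false in general. *)

theory Defs
  imports "HOL-Probability.Probability"
begin

text \<open>
  Edge sets on \<open>[N]\<close> are symmetric relations on \<open>{1..N}\<close>. Loops are allowed; they affect neither
  distances nor path probabilities for pairwise distinct vertices. There are finitely many edge
  sets on \<open>[N]\<close>, so a random graph is a random variable for the discrete sigma-algebra on them.
\<close>

definition edge_sets :: "nat \<Rightarrow> (nat \<times> nat) set set" where
  "edge_sets N = {E. E \<subseteq> {1..N} \<times> {1..N} \<and> sym E}"

definition network_model :: "'a measure \<Rightarrow> (nat \<Rightarrow> 'a \<Rightarrow> (nat \<times> nat) set) \<Rightarrow> bool" where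
  "network_model M G \<longleftrightarrow>
     prob_space M \<and> (\<forall>N\<ge>1. G N \<in> M \<rightarrow>\<^sub>M count_space (edge_sets N))"

definition is_walk :: "(nat \<times> nat) set \<Rightarrow> (nat \<Rightarrow> nat) \<Rightarrow> nat \<Rightarrow> bool" where
  "is_walk E v l \<longleftrightarrow> (\<forall>k\<in>{1..l}. (v (k - 1), v k) \<in> E)"

text \<open>The infimum of the empty set is \<open>\<infinity>\<close>, which is the distance of vertices that are not connected.\<close>

definition graph_dist :: "(nat \<times> nat) set \<Rightarrow> nat \<Rightarrow> nat \<Rightarrow> enat" where
  "graph_dist E v w = (INF n\<in>{n. \<exists>p. p 0 = v \<and> p n = w \<and> is_walk E p n}. enat n)"

definition assumption_CM :: "'a measure \<Rightarrow> (nat \<Rightarrow> 'a \<Rightarrow> (nat \<times> nat) set) \<Rightarrow> real \<Rightarrow> bool" where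
  "assumption_CM M G \<gamma> \<longleftrightarrow>
     (\<exists>\<kappa>::real. \<forall>N\<ge>1. \<forall>l v. inj_on v {0..l} \<longrightarrow> v ` {0..l} \<subseteq> {1..N} \<longrightarrow>
        measure M {\<omega> \<in> space M. is_walk (G N \<omega>) v l}
          \<le> (\<Prod>k=1..l. \<kappa> * real (v (k - 1)) powr (-\<gamma>) * real (v k) powr (-\<gamma>)
                           * real N powr (2 * \<gamma> - 1)))"

text \<open>
  \<open>V N\<close> and \<open>W N\<close> are uniform on \<open>[N]\<close>, and \<open>G N\<close>, \<open>V N\<close>, \<open>W N\<close> are mutually independent
  (\<open>V N\<close> is independent of \<open>W N\<close>, and \<open>G N\<close> is independent of the pair). The library's
  \<open>indep_var\<close> needs both variables to have the same type, so for \<open>G N\<close> and the pair the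
  generated sigma-algebras are used.
\<close>

definition independent_uniform_vertices ::
  "'a measure \<Rightarrow> (nat \<Rightarrow> 'a \<Rightarrow> (nat \<times> nat) set) \<Rightarrow> (nat \<Rightarrow> 'a \<Rightarrow> nat) \<Rightarrow> (nat \<Rightarrow> 'a \<Rightarrow> nat) \<Rightarrow> bool" where
  "independent_uniform_vertices M G V W \<longleftrightarrow>
     (\<forall>N\<ge>1.
        distr M (count_space {1..N}) (V N) = uniform_count_measure {1..N} \<and>
        distr M (count_space {1..N}) (W N) = uniform_count_measure {1..N} \<and>
        prob_space.indep_var M (count_space {1..N}) (V N) (count_space {1..N}) (W N) \<and>
        prob_space.indep_set M
          (sets (vimage_algebra (space M) (G N) (count_space (edge_sets N))))
          (sets (vimage_algebra (space M) (\<lambda>\<omega>. (V N \<omega>, W N \<omega>))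
                   (count_space ({1..N} \<times> {1..N})))))"

text \<open>
  The meaning of ``\<open>X N \<ge> a N + O(1)\<close> with high probability'': the error term is bounded in
  probability, i.e. the probability of \<open>X N \<ge> a N - C\<close> tends to 1 as first \<open>N\<close> and then \<open>C\<close> tends
  to infinity. Equivalently, \<open>X N \<ge> a N - c N\<close> with probability tending to 1, for every \<open>c\<close>
  tending to infinity. One cannot ask for a single \<open>C\<close> that makes the probability tend to 1 in the
  case of typical distances: under independent edges of probability
  \<open>min 1 (\<kappa> v\<^bsup>-\<gamma>\<^esup> w\<^bsup>-\<gamma>\<^esup> N\<^bsup>2\<gamma>-1\<^esup>)\<close>, the two endpoints both lie in \<open>[\<epsilon>N]\<close> with probability about
  \<open>\<epsilon>\<^sup>2\<close>, and this shortens their distance by an amount of order \<open>log log (1/\<epsilon>)\<close>.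
\<close>

definition whp_ge_plus_O1 :: "'a measure \<Rightarrow> (nat \<Rightarrow> 'a \<Rightarrow> ereal) \<Rightarrow> (nat \<Rightarrow> real) \<Rightarrow> bool" where
  "whp_ge_plus_O1 M X a \<longleftrightarrow>
     (\<forall>\<epsilon>>0. \<exists>C::real. \<forall>\<^sub>F N in sequentially.
        measure M {\<omega> \<in> space M. X N \<omega> \<ge> ereal (a N - C)} \<ge> 1 - \<epsilon>)"

end

theory Submission
  imports Defs
begin

text \<open>
  The proof is a first moment argument with truncation. An expected number of short paths is dominated
  by paths through vertices with very small index, which are hubs but are too rare to be seen from
  a typical starting point. Such paths have to be discarded before counting. To this end
  cutoffs \<open>t k\<close> are fixed which decrease with \<open>k\<close>, and a shortest path \<open>p 0, \<dots>, p n\<close> between \<open>v\<close> and \<open>w\<close>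
  is called good if \<open>p i \<ge> t (min i (n - i))\<close> for all inner \<open>i\<close>. A path that is not good contains an
  initial segment, seen from \<open>v\<close> or from \<open>w\<close>, that respects the cutoffs until its last vertex falls
  below one (lemma \<open>path_good_or_drops\<close>). It then suffices that both
  such drops and good paths of the given length are unlikely.

  Both probabilities come from one union bound (lemma \<open>prob_path_through_le\<close>). As the edge weights
  \<open>\<kappa> v\<^sup>-\<^sup>\<gamma> w\<^sup>-\<^sup>\<gamma> N\<^sup>2\<^sup>\<gamma>\<^sup>-\<^sup>1\<close> are a product of a function of \<open>v\<close> and a function of \<open>w\<close>, the sum over all paths
  factorises into power sums over single vertices. With \<open>x k = N / t k\<close>, a layer of inner vertices above
  \<open>t k\<close> contributes a constant times \<open>x k powr (2 \<gamma> - 1)\<close>, and the vertices below \<open>t k\<close> at the end of a drop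
  contribute a constant times \<open>x k powr (\<gamma> - 1)\<close>. The drop at step \<open>k\<close> has probability of order \<open>2\<^sup>-\<^sup>k\<close>
  if \<open>x (k + 1)\<close> is of order \<open>x k\<close> to the power \<open>\<gamma> / (1 - \<gamma>)\<close>. Hence \<open>x k\<close> is of the form
  \<open>exp (c (\<gamma> / (1 - \<gamma>))\<^sup>k)\<close> up to a constant, and increasing \<open>c\<close> makes all drops together as unlikely as
  desired (lemma \<open>prob_drop_le\<close>).

  For end vertices of order \<open>N\<close>, a good path with at most \<open>2 m + 1\<close> edges has probability at most of order
  \<open>x (m + 1) powr (2 - 2 \<gamma>) / N\<close> (lemma \<open>prob_good_le\<close>). This tends to 0 as long as \<open>x (m + 1) \<le> N\<close>, because
  \<open>2 - 2 \<gamma> < 1\<close>. The condition allows \<open>m\<close> up to \<open>ln (ln N) / ln (\<gamma> / (1 - \<gamma>))\<close> minus a constant that depends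
  on \<open>c\<close>, that is, on the admitted probability of failure. Since the truncation is applied from both ends,
  a path of length \<open>n\<close> only meets cutoffs up to step \<open>n div 2\<close>, which gives the factor 2 in the bound.
\<close>

section \<open>Power sums\<close>

lemma powr_difference_mean_value:
  fixes u :: real
  assumes "1 < u"
  obtains z where "u - 1 < z" "z < u" "u powr d - (u - 1) powr d = d * z powr (d - 1)"
proof -
  have "\<exists>z>u - 1. z < u \<and> u powr d - (u - 1) powr d = (u - (u - 1)) * (d * z powr (d - 1))"
    using assms by (intro MVT2) (auto intro!: derivative_eq_intros simp: powr_diff field_simps)
  then show ?thesis using that by auto
qed

lemma sum_powr_initial_segment_le:
  fixes d :: real
  assumes "0 < d" "d \<le> 1"
  shows "(\<Sum>u=1..n. real u powr (d - 1)) \<le> real n powr d / d"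
proof (induction n)
  case (Suc n)
  have "real (Suc n) powr (d - 1) \<le> (real (Suc n) powr d - real n powr d) / d"
  proof (cases "n = 0")
    case True
    with assms show ?thesis by (simp add: field_simps)
  next
    case False
    then obtain z where z: "real n < z" "z < real (Suc n)"
      "real (Suc n) powr d - real n powr d = d * z powr (d - 1)"
      using powr_difference_mean_value[of "real (Suc n)" d] by auto
    have "real (Suc n) powr (d - 1) \<le> z powr (d - 1)"
      using z assms False by (intro powr_mono2') auto
    with z assms show ?thesis by simp
  qed
  with Suc show ?case by (simp add: diff_divide_distrib)
qed simp

lemma sum_powr_below_le:
  fixes d t :: real
  assumes "0 < d" "d \<le> 1" "0 < t"
  shows "(\<Sum>u | u \<in> {1..N} \<and> real u < t. real u powr (d - 1)) \<le> t powr d / d"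
proof -
  have "(\<Sum>u | u \<in> {1..N} \<and> real u < t. real u powr (d - 1))
      \<le> (\<Sum>u=1..nat \<lfloor>t\<rfloor>. real u powr (d - 1))"
    by (intro sum_mono2) (auto simp: le_nat_floor)
  also have "\<dots> \<le> real (nat \<lfloor>t\<rfloor>) powr d / d"
    by (rule sum_powr_initial_segment_le[OF assms(1,2)])
  also have "\<dots> \<le> t powr d / d"
    using assms by (intro divide_right_mono powr_mono2) auto
  finally show ?thesis .
qed

text \<open>
  The mean value theorem bounds each summand after the first by a difference of consecutive values
  of \<open>x powr - s / s\<close>. The first summand is kept apart, because for \<open>m = 1\<close> that difference
  would involve \<open>0 powr - s\<close>, which is \<open>0\<close> rather than infinite.
\<close>

lemma sum_powr_tail_telescope_le:
  fixes s :: real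
  assumes "0 < s" "1 \<le> m" "m \<le> n"
  shows "(\<Sum>u=m..n. real u powr (- s - 1))
    \<le> real m powr (- s - 1) + (real m powr (- s) - real n powr (- s)) / s"
  using assms(3)
proof (induction n rule: dec_induct)
  case (step n)
  obtain z where z: "real n < z" "z < real (Suc n)"
    "real (Suc n) powr (- s) - real n powr (- s) = - s * z powr (- s - 1)"
    using powr_difference_mean_value[of "real (Suc n)" "- s"] step assms by auto
  have "real (Suc n) powr (- s - 1) \<le> z powr (- s - 1)"
    using z assms by (intro powr_mono2') auto
  also have "z powr (- s - 1) = (real n powr (- s) - real (Suc n) powr (- s)) / s"
    using z assms by (simp add: field_simps)
  finally show ?case
    using step by (simp add: diff_divide_distrib)
qed simp

text \<open>
  The bound has the same form for \<open>t < 1\<close> as for \<open>t \<ge> 1\<close>, so cutoffs can be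
  arbitrary positive reals and need no rounding.
\<close>

lemma sum_powr_tail_le:
  fixes s t :: real
  assumes "0 < s" "0 < t"
  shows "(\<Sum>u | u \<in> {1..N} \<and> t \<le> real u. real u powr (- s - 1)) \<le> (1 + 1 / s) * t powr (- s)"
proof -
  define m where "m = nat \<lceil>t\<rceil>"
  have m: "1 \<le> m" "t \<le> real m"
    using assms by (auto simp: m_def real_nat_ceiling_ge) linarith
  have "m \<le> u" if "t \<le> real u" for u
    using that by (simp add: m_def nat_ceiling_le_eq)
  with m have set_eq: "{u. u \<in> {1..N} \<and> t \<le> real u} = {m..N}" by force
  show ?thesis
  proof (cases "m \<le> N")
    case True
    have "(\<Sum>u=m..N. real u powr (- s - 1))
        \<le> real m powr (- s - 1) + (real m powr (- s) - real N powr (- s)) / s"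
      by (rule sum_powr_tail_telescope_le[OF assms(1) m(1) True])
    also have "\<dots> \<le> real m powr (- s) + real m powr (- s) / s"
      using m assms by (intro add_mono divide_right_mono powr_mono) auto
    also have "\<dots> = (1 + 1 / s) * real m powr (- s)" by (simp add: algebra_simps)
    also have "\<dots> \<le> (1 + 1 / s) * t powr (- s)"
      using m assms by (intro mult_left_mono powr_mono2') auto
    finally show ?thesis by (simp only: set_eq)
  next
    case False
    then have "{u. u \<in> {1..N} \<and> t \<le> real u} = {}" unfolding set_eq by simp
    then show ?thesis using assms by (simp only: sum.empty) simp
  qed
qed

section \<open>Walks and shortest paths\<close>

lemma is_walk_iff: "is_walk E p n \<longleftrightarrow> (\<forall>i<n. (p i, p (Suc i)) \<in> E)"
proof
  assume "is_walk E p n"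
  then show "\<forall>i<n. (p i, p (Suc i)) \<in> E"
    by (auto simp: is_walk_def dest!: bspec[of _ _ "Suc _"])
next
  assume "\<forall>i<n. (p i, p (Suc i)) \<in> E"
  then have "(p (k - 1), p k) \<in> E" if "k \<in> {1..n}" for k
    using that by (cases k) auto
  then show "is_walk E p n" by (auto simp: is_walk_def)
qed

lemma is_walk_cong: "(\<And>i. i \<le> n \<Longrightarrow> p i = q i) \<Longrightarrow> is_walk E p n = is_walk E q n"
  by (auto simp: is_walk_iff)

lemma is_walk_step: "is_walk E p n \<Longrightarrow> i < n \<Longrightarrow> (p i, p (Suc i)) \<in> E"
  by (simp add: is_walk_iff)

lemma is_walkI: "(\<And>i. i < n \<Longrightarrow> (p i, p (Suc i)) \<in> E) \<Longrightarrow> is_walk E p n"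
  by (simp add: is_walk_iff)

lemma is_walk_prefix: "is_walk E p n \<Longrightarrow> k \<le> n \<Longrightarrow> is_walk E p k"
  by (auto simp: is_walk_def)

lemma is_walk_rev:
  assumes "sym E" "is_walk E p n"
  shows "is_walk E (\<lambda>i. p (n - i)) n"
proof (rule is_walkI)
  fix i assume "i < n"
  then have "(p (n - Suc i), p (Suc (n - Suc i))) \<in> E"
    by (intro is_walk_step[OF assms(2)]) auto
  with \<open>i < n\<close> show "(p (n - i), p (n - Suc i)) \<in> E"
    using assms(1) by (auto simp: Suc_diff_Suc dest: symD)
qed

lemma is_walk_vertices:
  assumes "E \<in> edge_sets N" "is_walk E p n" "p 0 \<in> {1..N}" "i \<le> n"
  shows "p i \<in> {1..N}"
proof (cases i)
  case (Suc j)
  then have "(p j, p i) \<in> E" using is_walk_step[OF assms(2), of j] assms(4) by auto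
  with assms(1) show ?thesis by (auto simp: edge_sets_def)
qed (use assms in auto)

text \<open>
  A repeated vertex could be used to cut out a loop. Injectivity matters because the
  product bound on path probabilities is available for pairwise distinct vertices only.
\<close>

lemma shortest_walk_inj:
  assumes "is_walk E p n" "p 0 = v" "p n = w"
    and shortest: "\<And>m q. q 0 = v \<Longrightarrow> q m = w \<Longrightarrow> is_walk E q m \<Longrightarrow> n \<le> m"
  shows "inj_on p {0..n}"
proof (rule linorder_inj_onI)
  fix i j assume ij: "i < j" "i \<in> {0..n}" "j \<in> {0..n}"
  show "p i \<noteq> p j"
  proof
    assume eq: "p i = p j"
    \<comment> \<open>Cut out the segment between the two visits to the same vertex.\<close>
    define q where "q k = (if k \<le> i then p k else p (k + (j - i)))" for k
    have "is_walk E q (n - (j - i))"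
    proof (rule is_walkI)
      fix k assume "k < n - (j - i)"
      then have k: "k + (j - i) < n" using ij by auto
      consider "k < i" | "k = i" | "k > i" by linarith
      then show "(q k, q (Suc k)) \<in> E"
      proof cases
        case 2
        then show ?thesis using is_walk_step[OF assms(1) k] ij eq by (simp add: q_def)
      qed (use is_walk_step[OF assms(1), of k] is_walk_step[OF assms(1) k] k in
          \<open>auto simp: q_def\<close>)
    qed
    moreover have "q 0 = v" using assms(2) by (simp add: q_def)
    moreover have "q (n - (j - i)) = w"
      using ij eq assms(3) by (cases "n = j") (auto simp: q_def)
    ultimately have "n \<le> n - (j - i)" using shortest by blast
    with ij show False by auto
  qed
qed auto

lemma graph_dist_less_obtains_path:
  assumes "graph_dist E v w < enat l"
  obtains p n where "n < l" "p 0 = v" "p n = w" "inj_on p {0..n}" "is_walk E p n"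
proof -
  define conn where "conn n \<longleftrightarrow> (\<exists>p. p 0 = v \<and> p n = w \<and> is_walk E p n)" for n
  obtain m where m: "conn m" "m < l"
    using assms by (auto simp: graph_dist_def INF_less_iff conn_def)
  define n where "n = (LEAST n. conn n)"
  have "conn n" "n \<le> m" using m by (auto simp: n_def intro: LeastI Least_le)
  then obtain p where p: "p 0 = v" "p n = w" "is_walk E p n" by (auto simp: conn_def)
  have "inj_on p {0..n}"
  proof (rule shortest_walk_inj[OF p(3,1,2)])
    show "n \<le> k" if "q 0 = v" "q k = w" "is_walk E q k" for k q
      unfolding n_def using that by (intro Least_le) (auto simp: conn_def)
  qed
  with p m \<open>n \<le> m\<close> that[of n p] show ?thesis by auto
qed

section \<open>The first drop below the cutoffs\<close>

definition path_through :: "(nat \<times> nat) set \<Rightarrow> (nat \<Rightarrow> nat set) \<Rightarrow> nat \<Rightarrow> bool" where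
  "path_through E S n \<longleftrightarrow> (\<exists>p. inj_on p {0..n} \<and> (\<forall>i\<le>n. p i \<in> S i) \<and> is_walk E p n)"

text \<open>
  The two families of sets encode the two kinds of paths in the dichotomy. Along \<open>drop_sets\<close> a path
  leaves \<open>v\<close> and has index below the cutoff for the first time at step \<open>k\<close>; along \<open>good_sets\<close> it
  joins \<open>v\<close> to \<open>w\<close> and respects, at each inner vertex, the cutoff belonging to the distance from
  the nearer end of the path.
\<close>

definition drop_sets :: "nat \<Rightarrow> (nat \<Rightarrow> real) \<Rightarrow> nat \<Rightarrow> nat \<Rightarrow> nat \<Rightarrow> nat set" where
  "drop_sets N t v k i =
     (if i = 0 then {v} else if i < k then {u \<in> {1..N}. t i \<le> real u}
      else {u \<in> {1..N}. real u < t i})"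

definition good_sets :: "nat \<Rightarrow> (nat \<Rightarrow> real) \<Rightarrow> nat \<Rightarrow> nat \<Rightarrow> nat \<Rightarrow> nat \<Rightarrow> nat set" where
  "good_sets N t v w n i =
     (if i = 0 then {v} else if i = n then {w} else {u \<in> {1..N}. t (min i (n - i)) \<le> real u})"

text \<open>
  A violated cutoff occurs at some distance \<open>k\<close> from one of the two ends. For the smallest such \<open>k\<close>,
  the segment between that end and the violation obeys all earlier cutoffs. Since \<open>2 * k \<le> n\<close>,
  only segments of length up to \<open>m\<close> arise.
\<close>

lemma path_good_or_drops:
  assumes E: "E \<in> edge_sets N" and v: "v \<in> {1..N}"
    and p: "p 0 = v" "p n = w" "inj_on p {0..n}" "is_walk E p n" and n: "n \<le> 2 * m + 1"
  shows "path_through E (good_sets N t v w n) n \<or>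
    (\<exists>k\<in>{1..m}. path_through E (drop_sets N t v k) k \<or> path_through E (drop_sets N t w k) k)"
proof (cases "\<forall>i\<in>{1..<n}. t (min i (n - i)) \<le> real (p i)")
  case True
  have p0: "p 0 \<in> {1..N}" using p(1) v by simp
  have "\<forall>i\<le>n. p i \<in> good_sets N t v w n i"
    using True p(1,2) is_walk_vertices[OF E p(4) p0] by (simp add: good_sets_def)
  with p show ?thesis by (auto simp: path_through_def)
next
  case False
  define low where "low k \<longleftrightarrow> 1 \<le> k \<and> 2 * k \<le> n \<and> (real (p k) < t k \<or> real (p (n - k)) < t k)" for k
  obtain i where i: "i \<in> {1..<n}" "real (p i) < t (min i (n - i))" using False by (auto simp: not_le)
  have "low (min i (n - i))" using i by (cases "i \<le> n - i") (auto simp: low_def min_def)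
  define k where "k = (LEAST k. low k)"
  have k: "low k" unfolding k_def using \<open>low (min i (n - i))\<close> by (rule LeastI[of low])
  have first: "t j \<le> real (p j) \<and> t j \<le> real (p (n - j))" if j: "1 \<le> j" "j < k" for j
  proof -
    have "\<not> low j" using not_less_Least[of j low] j(2) unfolding k_def by blast
    moreover have "2 * j \<le> n" using j(2) k unfolding low_def by linarith
    ultimately show ?thesis using j(1) unfolding low_def by (simp add: not_less)
  qed
  have km: "k \<in> {1..m}" "k \<le> n" using k n by (auto simp: low_def)
  have drop: "path_through E (drop_sets N t (q 0) k) k"
    if q: "inj_on q {0..n}" "is_walk E q n" "q 0 \<in> {1..N}" "real (q k) < t k"
      "\<And>j. 1 \<le> j \<Longrightarrow> j < k \<Longrightarrow> t j \<le> real (q j)" for q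
  proof -
    have "\<forall>i\<le>k. q i \<in> drop_sets N t (q 0) k i"
      using q(4,5) is_walk_vertices[OF E q(2,3)] km(2) by (simp add: drop_sets_def)
    moreover have "inj_on q {0..k}" using q(1) km by (auto intro: inj_on_subset)
    ultimately show ?thesis
      using is_walk_prefix[OF q(2) km(2)] by (auto simp: path_through_def)
  qed
  show ?thesis
  proof (cases "real (p k) < t k")
    case True
    have "path_through E (drop_sets N t (p 0) k) k"
      by (rule drop[OF p(3,4)]) (use p(1) v True first in auto)
    then show ?thesis using km(1) p(1) by blast
  next
    case False
    then have low_end: "real (p (n - k)) < t k" using k by (simp add: low_def)
    have "sym E" using E by (simp add: edge_sets_def)
    have "path_through E (drop_sets N t (p (n - 0)) k) k"
    proof (rule drop)
      show "inj_on (\<lambda>i. p (n - i)) {0..n}"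
      proof (rule inj_onI)
        fix i j assume ij: "i \<in> {0..n}" "j \<in> {0..n}" "p (n - i) = p (n - j)"
        have "n - i = n - j" by (rule inj_onD[OF p(3) ij(3)]) auto
        with ij show "i = j" by auto
      qed
      show "is_walk E (\<lambda>i. p (n - i)) n" by (rule is_walk_rev) fact+
      show "p (n - 0) \<in> {1..N}" using is_walk_vertices[OF E p(4), of n] p(1) v by simp
    qed (use low_end first in auto)
    then show ?thesis using km(1) p(2) by auto
  qed
qed

section \<open>Expected numbers of paths\<close>

text \<open>
  The edge weights form a rank-one kernel: every inner vertex belongs to two edges and contributes
  the square of its weight, so a sum over paths becomes a product of sums over single vertices.
\<close>

lemma path_weight_factorises:
  fixes K :: real and f :: "nat \<Rightarrow> real"
  assumes "1 \<le> n"
  shows "(\<Prod>k=1..n. K * f (k - 1) * f k) = K * f 0 * f n * (\<Prod>i\<in>{1..<n}. K * (f i)\<^sup>2)"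
  using assms
proof (induction n rule: dec_induct)
  case (step n)
  then show ?case by (simp add: power2_eq_square atLeastLessThanSuc algebra_simps)
qed simp

text \<open>
  Split the path in the middle; each half contributes at most the full geometric sum up to \<open>m\<close>.
\<close>

lemma sum_powers_half_path_le:
  fixes \<rho> :: real
  assumes "0 \<le> \<rho>" "n div 2 \<le> m"
  shows "(\<Sum>i\<in>{1..<n}. \<rho> ^ min i (n - i)) \<le> 2 * (\<Sum>i\<in>{1..<Suc m}. \<rho> ^ i)"
proof -
  define g where "g i = (if i \<le> m then \<rho> ^ i else 0)" for i
  have g_sum: "(\<Sum>i\<in>{1..<n}. g i) \<le> (\<Sum>i\<in>{1..<Suc m}. \<rho> ^ i)"
  proof -
    have "(\<Sum>i\<in>{1..<n}. g i) = (\<Sum>i\<in>{1..<n} \<inter> {..m}. \<rho> ^ i)"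
      by (auto simp: g_def sum.inter_restrict)
    also have "\<dots> \<le> (\<Sum>i\<in>{1..<Suc m}. \<rho> ^ i)"
      using assms by (intro sum_mono2) auto
    finally show ?thesis .
  qed
  have "\<rho> ^ min i (n - i) \<le> g i + g (n - i)" if "i \<in> {1..<n}" for i
    using that assms by (auto simp: g_def min_def)
  then have "(\<Sum>i\<in>{1..<n}. \<rho> ^ min i (n - i)) \<le> (\<Sum>i\<in>{1..<n}. g i) + (\<Sum>i\<in>{1..<n}. g (n - i))"
    unfolding sum.distrib[symmetric] by (rule sum_mono)
  also have "(\<Sum>i\<in>{1..<n}. g (n - i)) = (\<Sum>i\<in>{1..<n}. g i)"
    by (rule sum.reindex_bij_witness[of _ "\<lambda>i. n - i" "\<lambda>i. n - i"]) auto
  finally show ?thesis using g_sum by linarith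
qed

text \<open>
  A single random graph on \<open>[N]\<close> with a fixed constant \<open>\<kappa>\<close>, so that the bounds below are explicit
  in \<open>N\<close> and \<open>\<kappa>\<close> before any limit is taken.
\<close>

locale cm_random_graph = prob_space M for M :: "'a measure" +
  fixes H :: "'a \<Rightarrow> (nat \<times> nat) set" and N :: nat and \<kappa> \<gamma> :: real
  assumes measurable_H: "H \<in> M \<rightarrow>\<^sub>M count_space (edge_sets N)"
    and N_pos: "1 \<le> N" and kappa_nonneg: "0 \<le> \<kappa>" and gamma: "1/2 < \<gamma>" "\<gamma> < 1"
    and walk_bound: "\<And>l v. inj_on v {0..l} \<Longrightarrow> v ` {0..l} \<subseteq> {1..N} \<Longrightarrow>
        prob {\<omega> \<in> space M. is_walk (H \<omega>) v l}
          \<le> (\<Prod>k=1..l. \<kappa> * real (v (k - 1)) powr (-\<gamma>) * real (v k) powr (-\<gamma>)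
                           * real N powr (2 * \<gamma> - 1))"
begin

lemma H_in_edge_sets: "\<omega> \<in> space M \<Longrightarrow> H \<omega> \<in> edge_sets N"
  using measurable_space[OF measurable_H] by simp

lemma event_H: "{\<omega> \<in> space M. P (H \<omega>)} \<in> events"
proof -
  have "H -` {E \<in> edge_sets N. P E} \<inter> space M \<in> events"
    by (rule measurable_sets[OF measurable_H]) auto
  also have "H -` {E \<in> edge_sets N. P E} \<inter> space M = {\<omega> \<in> space M. P (H \<omega>)}"
    using H_in_edge_sets by auto
  finally show ?thesis .
qed

abbreviation edge_const :: real where
  "edge_const \<equiv> \<kappa> * real N powr (2 * \<gamma> - 1)"

text \<open>
  The union bound over all injective choices of vertices, enlarged to all choices in order to obtain
  a product of independent sums. The two end vertices carry weight \<open>u powr - \<gamma>\<close>, each inner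
  one carries \<open>u powr (- 2 * \<gamma>)\<close>, and a path with \<open>n\<close> edges has \<open>n - 1\<close> inner vertices, so
  exactly one factor \<open>edge_const\<close> is left over.
\<close>

lemma prob_path_through_le:
  assumes n: "1 \<le> n" and S: "\<And>i. i \<le> n \<Longrightarrow> S i \<subseteq> {1..N}"
  shows "prob {\<omega> \<in> space M. path_through (H \<omega>) S n}
    \<le> edge_const * (\<Sum>u\<in>S 0. real u powr (-\<gamma>)) * (\<Sum>u\<in>S n. real u powr (-\<gamma>))
      * (\<Prod>i\<in>{1..<n}. edge_const * (\<Sum>u\<in>S i. real u powr (- 2 * \<gamma>)))"
proof -
  define h where "h i u = (if i = 0 then edge_const * real u powr (-\<gamma>)
      else if i = n then real u powr (-\<gamma>) else edge_const * real u powr (- 2 * \<gamma>))" for i u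
  have h_nonneg: "0 \<le> h i u" for i u using kappa_nonneg by (auto simp: h_def)
  have split: "{0..n} = insert 0 (insert n {1..<n})" using n by auto
  have prod_split: "(\<Prod>i\<in>{0..n}. a i) = a 0 * a n * (\<Prod>i\<in>{1..<n}. a i)" for a :: "nat \<Rightarrow> real"
    unfolding split using n by (simp add: mult.assoc)
  have walk_weight: "(\<Prod>k=1..n. \<kappa> * real (p (k - 1)) powr (-\<gamma>) * real (p k) powr (-\<gamma>)
      * real N powr (2 * \<gamma> - 1)) = (\<Prod>i\<in>{0..n}. h i (p i))" for p
  proof -
    have "(\<Prod>k=1..n. \<kappa> * real (p (k - 1)) powr (-\<gamma>) * real (p k) powr (-\<gamma>)
        * real N powr (2 * \<gamma> - 1))
      = (\<Prod>k=1..n. edge_const * real (p (k - 1)) powr (-\<gamma>) * real (p k) powr (-\<gamma>))"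
      by (simp add: mult_ac)
    also have "\<dots> = edge_const * real (p 0) powr (-\<gamma>) * real (p n) powr (-\<gamma>)
        * (\<Prod>i\<in>{1..<n}. edge_const * (real (p i) powr (-\<gamma>))\<^sup>2)"
      by (rule path_weight_factorises[OF n])
    also have "\<dots> = (\<Prod>i\<in>{0..n}. h i (p i))"
      using n unfolding prod_split
      by (auto simp: h_def power2_eq_square simp flip: powr_add intro!: prod.cong)
    finally show ?thesis .
  qed
  define paths where "paths = {p \<in> PiE {0..n} S. inj_on p {0..n}}"
  have finS: "finite (S i)" if "i \<le> n" for i using S[OF that] by (rule finite_subset) auto
  have fin: "finite (PiE {0..n} S)" by (intro finite_PiE) (auto intro: finS)
  then have finite_paths: "finite paths" by (auto simp: paths_def)
  have "{\<omega> \<in> space M. path_through (H \<omega>) S n} \<subseteq> (\<Union>p\<in>paths. {\<omega> \<in> space M. is_walk (H \<omega>) p n})"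
  proof
    fix \<omega> assume "\<omega> \<in> {\<omega> \<in> space M. path_through (H \<omega>) S n}"
    then obtain p where p: "\<omega> \<in> space M" "inj_on p {0..n}" "\<forall>i\<le>n. p i \<in> S i" "is_walk (H \<omega>) p n"
      by (auto simp: path_through_def)
    have "restrict p {0..n} \<in> paths"
      using p by (auto simp: paths_def inj_on_def)
    moreover have "is_walk (H \<omega>) (restrict p {0..n}) n"
      using p(4) by (subst is_walk_cong[of n _ p]) auto
    ultimately show "\<omega> \<in> (\<Union>p\<in>paths. {\<omega> \<in> space M. is_walk (H \<omega>) p n})"
      using p(1) by blast
  qed
  then have "prob {\<omega> \<in> space M. path_through (H \<omega>) S n}
      \<le> prob (\<Union>p\<in>paths. {\<omega> \<in> space M. is_walk (H \<omega>) p n})"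
    by (intro finite_measure_mono sets.finite_UN finite_paths event_H)
  also have "\<dots> \<le> (\<Sum>p\<in>paths. prob {\<omega> \<in> space M. is_walk (H \<omega>) p n})"
    by (intro finite_measure_subadditive_finite finite_paths) (auto intro: event_H)
  also have "\<dots> \<le> (\<Sum>p\<in>paths. \<Prod>i\<in>{0..n}. h i (p i))"
  proof (rule sum_mono)
    fix p assume "p \<in> paths"
    then have "inj_on p {0..n}" "p ` {0..n} \<subseteq> {1..N}"
      using S by (fastforce simp: paths_def PiE_iff)+
    from walk_bound[OF this] show "prob {\<omega> \<in> space M. is_walk (H \<omega>) p n} \<le> (\<Prod>i\<in>{0..n}. h i (p i))"
      by (simp only: walk_weight)
  qed
  also have "\<dots> \<le> (\<Sum>p\<in>PiE {0..n} S. \<Prod>i\<in>{0..n}. h i (p i))"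
    using fin h_nonneg by (intro sum_mono2) (auto simp: paths_def intro: prod_nonneg)
  also have "\<dots> = (\<Prod>i\<in>{0..n}. \<Sum>u\<in>S i. h i u)"
    by (rule prod_sum_PiE[symmetric]) (auto intro: finS)
  also have "\<dots> = edge_const * (\<Sum>u\<in>S 0. real u powr (-\<gamma>)) * (\<Sum>u\<in>S n. real u powr (-\<gamma>))
      * (\<Prod>i\<in>{1..<n}. edge_const * (\<Sum>u\<in>S i. real u powr (- 2 * \<gamma>)))"
    using n unfolding prod_split by (auto simp: h_def sum_distrib_left)
  finally show ?thesis .
qed

end

section \<open>Doubly exponential cutoffs\<close>

definition growth :: "real \<Rightarrow> real" where
  "growth \<gamma> = \<gamma> / (1 - \<gamma>)"

text \<open>
  Chosen so that \<open>layer_const \<kappa> \<gamma> / 2\<close> dominates the constant in the sum over one layer of inner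
  vertices; the factor 2 makes every layer contribute an extra 1/2, which gives the convergence
  of the sums over path lengths.
\<close>

definition layer_const :: "real \<Rightarrow> real \<Rightarrow> real" where
  "layer_const \<kappa> \<gamma> = 2 * (\<kappa> * (1 + 1 / (2 * \<gamma> - 1)) + 1)"

text \<open>
  Up to the constant factor, \<open>N / cutoff N \<kappa> \<gamma> c k\<close> is \<open>exp (c * growth \<gamma> ^ k)\<close>. It is an exact
  solution of the recursion \<open>x (k + 1) = B * x k powr growth \<gamma>\<close> (with \<open>B\<close> depending on \<open>\<kappa>\<close> and \<open>\<gamma>\<close>),
  which balances the number of ways to reach layer \<open>k\<close> against the chance of dropping
  below the next cutoff. The parameter \<open>c\<close> sets how low the cutoffs are.
\<close>

definition cutoff :: "nat \<Rightarrow> real \<Rightarrow> real \<Rightarrow> real \<Rightarrow> nat \<Rightarrow> real" where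
  "cutoff N \<kappa> \<gamma> c k =
     real N * layer_const \<kappa> \<gamma> powr (1 / (2 * \<gamma> - 1)) * exp (- c * growth \<gamma> ^ k)"

definition drop_const :: "real \<Rightarrow> real \<Rightarrow> real" where
  "drop_const \<kappa> \<gamma> = \<kappa> * layer_const \<kappa> \<gamma> powr ((1 - \<gamma>) / (2 * \<gamma> - 1)) / (1 - \<gamma>)"

lemma growth_gt_1: "1/2 < \<gamma> \<Longrightarrow> \<gamma> < 1 \<Longrightarrow> 1 < growth \<gamma>"
  by (simp add: growth_def field_simps)

text \<open>
  A geometric sum, with \<open>(growth \<gamma> - 1) * (1 - \<gamma>) = 2 * \<gamma> - 1\<close>. This identity is what makes the
  powers of \<open>growth \<gamma>\<close> cancel in the probability of a drop.
\<close>

lemma sum_growth_powers: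
  assumes "\<gamma> < 1" "1 \<le> k"
  shows "(2 * \<gamma> - 1) * (\<Sum>i\<in>{1..<k}. growth \<gamma> ^ i) = (1 - \<gamma>) * growth \<gamma> ^ k - \<gamma>"
  using assms(2)
proof (induction k rule: dec_induct)
  case base
  then show ?case using assms by (simp add: growth_def)
next
  case (step k)
  have "(1 - \<gamma>) * growth \<gamma> ^ Suc k = \<gamma> * growth \<gamma> ^ k"
    using assms(1) by (simp add: growth_def)
  with step show ?case by (simp add: algebra_simps)
qed

lemma sum_half_powers_le: "(\<Sum>k=1..m. (1/2::real) ^ (k - 1)) \<le> 2"
proof -
  have "(\<Sum>k=1..m. (1/2::real) ^ (k - 1)) = 2 - 2 * (1/2) ^ m"
    by (induction m) auto
  then show ?thesis by simp
qed

context cm_random_graph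
begin

lemma layer_const_ge: "2 \<le> layer_const \<kappa> \<gamma>" "2 * \<kappa> * (1 + 1 / (2 * \<gamma> - 1)) \<le> layer_const \<kappa> \<gamma>"
  using kappa_nonneg gamma by (auto simp: layer_const_def)

lemma cutoff_pos: "0 < cutoff N \<kappa> \<gamma> c k"
  using N_pos layer_const_ge by (simp add: cutoff_def)

lemma cutoff_powr:
  "cutoff N \<kappa> \<gamma> c k powr d = real N powr d * layer_const \<kappa> \<gamma> powr (d / (2 * \<gamma> - 1))
     * exp (- c * d * growth \<gamma> ^ k)"
  using N_pos layer_const_ge
  by (simp add: cutoff_def powr_mult powr_powr exp_powr_real mult_ac)

text \<open>
  The factor by which the bound grows when a path is extended by one vertex above the cutoff.
  It is governed by the cutoff alone, since \<open>2 * \<gamma> > 1\<close> makes the power sum converge.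
\<close>

lemma layer_weight_le:
  "edge_const * (\<Sum>u | u \<in> {1..N} \<and> cutoff N \<kappa> \<gamma> c k \<le> real u. real u powr (- 2 * \<gamma>))
     \<le> exp (c * (2 * \<gamma> - 1) * growth \<gamma> ^ k) / 2"
proof -
  let ?b = "2 * \<gamma> - 1" and ?L = "layer_const \<kappa> \<gamma>"
  have "(\<Sum>u | u \<in> {1..N} \<and> cutoff N \<kappa> \<gamma> c k \<le> real u. real u powr (- ?b - 1))
      \<le> (1 + 1 / ?b) * cutoff N \<kappa> \<gamma> c k powr (- ?b)"
    using gamma by (intro sum_powr_tail_le cutoff_pos) simp
  also have "cutoff N \<kappa> \<gamma> c k powr (- ?b) = real N powr (- ?b) / ?L * exp (c * ?b * growth \<gamma> ^ k)"
  proof -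
    have "- ?b / ?b = -1" using gamma by (simp add: field_simps)
    with layer_const_ge(1) show ?thesis unfolding cutoff_powr by (simp only:) (simp add: powr_minus_divide, simp add: algebra_simps)
  qed
  finally have "edge_const * (\<Sum>u | u \<in> {1..N} \<and> cutoff N \<kappa> \<gamma> c k \<le> real u. real u powr (- ?b - 1))
      \<le> edge_const * ((1 + 1 / ?b) * (real N powr (- ?b) / ?L * exp (c * ?b * growth \<gamma> ^ k)))"
    using kappa_nonneg by (intro mult_left_mono) auto
  also have "\<dots> = (real N powr ?b * real N powr (- ?b))
      * ((\<kappa> * (1 + 1 / ?b) / ?L) * exp (c * ?b * growth \<gamma> ^ k))"
    by (simp add: mult_ac)
  also have "real N powr ?b * real N powr (- ?b) = 1"
    using N_pos by (simp flip: powr_add)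
  also have "1 * ((\<kappa> * (1 + 1 / ?b) / ?L) * exp (c * ?b * growth \<gamma> ^ k))
      = (\<kappa> * (1 + 1 / ?b) / ?L) * exp (c * ?b * growth \<gamma> ^ k)"
    by simp
  also have "\<dots> \<le> (1 / 2) * exp (c * ?b * growth \<gamma> ^ k)"
    using layer_const_ge by (intro mult_right_mono) (auto simp: divide_simps)
  finally show ?thesis by simp
qed

lemma prod_layer_weights_le:
  assumes "finite I"
  shows "(\<Prod>i\<in>I. edge_const * (\<Sum>u | u \<in> {1..N} \<and> cutoff N \<kappa> \<gamma> c (r i) \<le> real u. real u powr (- 2 * \<gamma>)))
    \<le> exp (c * ((2 * \<gamma> - 1) * (\<Sum>i\<in>I. growth \<gamma> ^ r i))) * (1/2) ^ card I"
proof -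
  have "(\<Prod>i\<in>I. edge_const * (\<Sum>u | u \<in> {1..N} \<and> cutoff N \<kappa> \<gamma> c (r i) \<le> real u. real u powr (- 2 * \<gamma>)))
      \<le> (\<Prod>i\<in>I. exp (c * (2 * \<gamma> - 1) * growth \<gamma> ^ r i) / 2)"
    using kappa_nonneg layer_weight_le by (intro prod_mono) (auto intro!: mult_nonneg_nonneg sum_nonneg)
  also have "\<dots> = exp (c * ((2 * \<gamma> - 1) * (\<Sum>i\<in>I. growth \<gamma> ^ r i))) * (1/2) ^ card I"
    using assms by (simp add: prod_dividef exp_sum sum_distrib_left mult.assoc power_divide)
  finally show ?thesis .
qed

lemma vertex_powr_le:
  assumes "0 < e" "e * real N \<le> real v"
  shows "real v powr (-\<gamma>) \<le> e powr (-\<gamma>) * real N powr (-\<gamma>)"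
  using powr_mono2'[of "-\<gamma>" "e * real N" "real v"] assms N_pos gamma by (simp add: powr_mult)

text \<open>
  The product over the inner layers is \<open>exp (c * ((1 - \<gamma>) * growth \<gamma> ^ k - \<gamma>))\<close> times a power of 1/2,
  whereas the sum over \<open>u < cutoff N \<kappa> \<gamma> c k\<close> is at most of order
  \<open>N powr (1 - \<gamma>) * exp (- c * (1 - \<gamma>) * growth \<gamma> ^ k)\<close>. The doubly exponential terms cancel and
  so do all powers of \<open>N\<close>. What remains is summable in \<open>k\<close> and small for large \<open>c\<close>.
\<close>

lemma prob_drop_le:
  assumes k: "1 \<le> k" and v: "v \<in> {1..N}" "0 < e" "e * real N \<le> real v"
  shows "prob {\<omega> \<in> space M. path_through (H \<omega>) (drop_sets N (cutoff N \<kappa> \<gamma> c) v k) k}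
    \<le> drop_const \<kappa> \<gamma> * e powr (-\<gamma>) * exp (- c * \<gamma>) * (1/2) ^ (k - 1)"
proof -
  let ?t = "cutoff N \<kappa> \<gamma> c" and ?S = "drop_sets N (cutoff N \<kappa> \<gamma> c) v k"
  let ?A = "layer_const \<kappa> \<gamma> powr ((1 - \<gamma>) / (2 * \<gamma> - 1))"
  have S0: "?S 0 = {v}" and Sk: "?S k = {u. u \<in> {1..N} \<and> real u < ?t k}"
    using k by (auto simp: drop_sets_def)
  have inner: "(\<Prod>i\<in>{1..<k}. edge_const * (\<Sum>u\<in>?S i. real u powr (- 2 * \<gamma>)))
      \<le> exp (c * ((1 - \<gamma>) * growth \<gamma> ^ k - \<gamma>)) * (1/2) ^ (k - 1)"
  proof -
    have "(\<Prod>i\<in>{1..<k}. edge_const * (\<Sum>u\<in>?S i. real u powr (- 2 * \<gamma>)))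
      = (\<Prod>i\<in>{1..<k}. edge_const * (\<Sum>u | u \<in> {1..N} \<and> ?t i \<le> real u. real u powr (- 2 * \<gamma>)))"
      by (intro prod.cong) (auto simp: drop_sets_def)
    also note prod_layer_weights_le[where I = "{1..<k}" and c = c and r = "\<lambda>i. i", OF finite_atLeastLessThan]
    finally show ?thesis unfolding sum_growth_powers[OF gamma(2) k] card_atLeastLessThan .
  qed
  have last: "(\<Sum>u\<in>?S k. real u powr (-\<gamma>))
      \<le> real N powr (1 - \<gamma>) * ?A * exp (- c * (1 - \<gamma>) * growth \<gamma> ^ k) / (1 - \<gamma>)"
    using sum_powr_below_le[of "1 - \<gamma>" "?t k" N] gamma cutoff_pos[of c k]
    unfolding Sk cutoff_powr by simp
  have "prob {\<omega> \<in> space M. path_through (H \<omega>) ?S k}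
    \<le> edge_const * (\<Sum>u\<in>?S 0. real u powr (-\<gamma>)) * (\<Sum>u\<in>?S k. real u powr (-\<gamma>))
      * (\<Prod>i\<in>{1..<k}. edge_const * (\<Sum>u\<in>?S i. real u powr (- 2 * \<gamma>)))"
    using v by (intro prob_path_through_le[OF k]) (auto simp: drop_sets_def)
  also have "\<dots> \<le> edge_const * (e powr (-\<gamma>) * real N powr (-\<gamma>))
      * (real N powr (1 - \<gamma>) * ?A * exp (- c * (1 - \<gamma>) * growth \<gamma> ^ k) / (1 - \<gamma>))
      * (exp (c * ((1 - \<gamma>) * growth \<gamma> ^ k - \<gamma>)) * (1/2) ^ (k - 1))"
    using kappa_nonneg vertex_powr_le[OF v(2,3)] last inner gamma unfolding S0
    by (intro mult_mono) (auto intro!: mult_nonneg_nonneg sum_nonneg prod_nonneg)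
  also have "\<dots> = (real N powr (2 * \<gamma> - 1) * real N powr (-\<gamma>) * real N powr (1 - \<gamma>))
      * (exp (- c * (1 - \<gamma>) * growth \<gamma> ^ k) * exp (c * ((1 - \<gamma>) * growth \<gamma> ^ k - \<gamma>)))
      * (drop_const \<kappa> \<gamma> * e powr (-\<gamma>) * (1/2) ^ (k - 1))"
    by (simp add: drop_const_def mult_ac)
  also have "real N powr (2 * \<gamma> - 1) * real N powr (-\<gamma>) * real N powr (1 - \<gamma>) = 1"
    using N_pos by (simp flip: powr_add)
  also have "exp (- c * (1 - \<gamma>) * growth \<gamma> ^ k) * exp (c * ((1 - \<gamma>) * growth \<gamma> ^ k - \<gamma>)) = exp (- c * \<gamma>)"
    by (simp add: algebra_simps flip: exp_add)
  finally show ?thesis by (simp add: mult_ac)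
qed

text \<open>
  Each half of the path contributes at most \<open>exp (c * (1 - \<gamma>) * growth \<gamma> ^ Suc m)\<close>. Since there are two fixed
  end vertices of order \<open>N\<close>, a factor \<open>1 / N\<close> is left, so these paths are unlikely to exist until
  \<open>growth \<gamma> ^ m\<close> is of order \<open>ln N\<close>.
\<close>

lemma prob_good_le:
  assumes n: "1 \<le> n" "n div 2 \<le> m" and c: "0 \<le> c" and "0 < e"
    and v: "v \<in> {1..N}" "e * real N \<le> real v" and w: "w \<in> {1..N}" "e * real N \<le> real w"
  shows "prob {\<omega> \<in> space M. path_through (H \<omega>) (good_sets N (cutoff N \<kappa> \<gamma> c) v w n) n}
    \<le> \<kappa> * e powr (- 2 * \<gamma>) / real N * exp (2 * (1 - \<gamma>) * (c * growth \<gamma> ^ Suc m)) * (1/2) ^ (n - 1)"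
proof -
  let ?t = "cutoff N \<kappa> \<gamma> c" and ?S = "good_sets N (cutoff N \<kappa> \<gamma> c) v w n"
  have S0: "?S 0 = {v}" and Sn: "?S n = {w}"
    using n by (auto simp: good_sets_def)
  have inner: "(\<Prod>i\<in>{1..<n}. edge_const * (\<Sum>u\<in>?S i. real u powr (- 2 * \<gamma>)))
      \<le> exp (2 * (1 - \<gamma>) * (c * growth \<gamma> ^ Suc m)) * (1/2) ^ (n - 1)"
  proof -
    have "(\<Prod>i\<in>{1..<n}. edge_const * (\<Sum>u\<in>?S i. real u powr (- 2 * \<gamma>)))
      = (\<Prod>i\<in>{1..<n}. edge_const *
          (\<Sum>u | u \<in> {1..N} \<and> ?t (min i (n - i)) \<le> real u. real u powr (- 2 * \<gamma>)))"
      by (intro prod.cong) (auto simp: good_sets_def)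
    also have "\<dots> \<le> exp (c * ((2 * \<gamma> - 1) * (\<Sum>i\<in>{1..<n}. growth \<gamma> ^ min i (n - i))))
        * (1/2) ^ (n - 1)"
      using prod_layer_weights_le[of "{1..<n}" c "\<lambda>i. min i (n - i)"] by simp
    also have "\<dots> \<le> exp (2 * (1 - \<gamma>) * (c * growth \<gamma> ^ Suc m)) * (1/2) ^ (n - 1)"
    proof (intro mult_right_mono)
      have "(2 * \<gamma> - 1) * (\<Sum>i\<in>{1..<n}. growth \<gamma> ^ min i (n - i))
          \<le> (2 * \<gamma> - 1) * (2 * (\<Sum>i\<in>{1..<Suc m}. growth \<gamma> ^ i))"
        using gamma growth_gt_1[OF gamma] n
        by (intro mult_left_mono sum_powers_half_path_le) auto
      also have "\<dots> = 2 * ((1 - \<gamma>) * growth \<gamma> ^ Suc m - \<gamma>)"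
        using sum_growth_powers[of \<gamma> "Suc m"] gamma by (simp add: algebra_simps)
      also have "\<dots> \<le> 2 * ((1 - \<gamma>) * growth \<gamma> ^ Suc m)"
        using gamma by simp
      finally have "c * ((2 * \<gamma> - 1) * (\<Sum>i\<in>{1..<n}. growth \<gamma> ^ min i (n - i)))
          \<le> c * (2 * ((1 - \<gamma>) * growth \<gamma> ^ Suc m))"
        using c by (rule mult_left_mono)
      then show "exp (c * ((2 * \<gamma> - 1) * (\<Sum>i\<in>{1..<n}. growth \<gamma> ^ min i (n - i))))
          \<le> exp (2 * (1 - \<gamma>) * (c * growth \<gamma> ^ Suc m))"
        by (simp only: exp_le_cancel_iff mult.left_commute mult.assoc)
    qed simp
    finally show ?thesis .
  qed
  have "prob {\<omega> \<in> space M. path_through (H \<omega>) ?S n}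
    \<le> edge_const * (\<Sum>u\<in>?S 0. real u powr (-\<gamma>)) * (\<Sum>u\<in>?S n. real u powr (-\<gamma>))
      * (\<Prod>i\<in>{1..<n}. edge_const * (\<Sum>u\<in>?S i. real u powr (- 2 * \<gamma>)))"
    using v w by (intro prob_path_through_le[OF n(1)]) (auto simp: good_sets_def)
  also have "\<dots> \<le> edge_const * (e powr (-\<gamma>) * real N powr (-\<gamma>)) * (e powr (-\<gamma>) * real N powr (-\<gamma>))
      * (exp (2 * (1 - \<gamma>) * (c * growth \<gamma> ^ Suc m)) * (1/2) ^ (n - 1))"
    using kappa_nonneg vertex_powr_le[OF \<open>0 < e\<close>] v w inner unfolding S0 Sn
    by (intro mult_mono) (auto intro!: mult_nonneg_nonneg sum_nonneg prod_nonneg)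
  also have "\<dots> = \<kappa> * (e powr (-\<gamma>) * e powr (-\<gamma>))
      * (real N powr (2 * \<gamma> - 1) * real N powr (-\<gamma>) * real N powr (-\<gamma>))
      * exp (2 * (1 - \<gamma>) * (c * growth \<gamma> ^ Suc m)) * (1/2) ^ (n - 1)"
    by (simp only: mult_ac)
  also have "real N powr (2 * \<gamma> - 1) * real N powr (-\<gamma>) * real N powr (-\<gamma>) = 1 / real N"
  proof -
    have "2 * \<gamma> - 1 + (-\<gamma>) + (-\<gamma>) = (-1::real)" by simp
    then show ?thesis using N_pos by (simp only: powr_add[symmetric]) (simp add: powr_minus_divide)
  qed
  also have "e powr (-\<gamma>) * e powr (-\<gamma>) = e powr (- 2 * \<gamma>)"
    by (simp flip: powr_add)
  finally show ?thesis by simp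
qed

text \<open>
  The dichotomy for shortest paths with at most \<open>2 * m + 1\<close> edges, summed over the step of the drop at
  either end and over the length of a good path. The assumption \<open>v \<noteq> w\<close> excludes the path of length 0.
\<close>

lemma prob_dist_less_le:
  assumes "0 \<le> c" "0 < e" "v \<noteq> w"
    and v: "v \<in> {1..N}" "e * real N \<le> real v" and w: "w \<in> {1..N}" "e * real N \<le> real w"
  shows "prob {\<omega> \<in> space M. graph_dist (H \<omega>) v w < enat (2 * m + 2)}
    \<le> 4 * drop_const \<kappa> \<gamma> * e powr (-\<gamma>) * exp (- c * \<gamma>)
      + 2 * \<kappa> * e powr (- 2 * \<gamma>) / real N * exp (2 * (1 - \<gamma>) * (c * growth \<gamma> ^ Suc m))"
proof -
  let ?drop = "\<lambda>x k. {\<omega> \<in> space M. path_through (H \<omega>) (drop_sets N (cutoff N \<kappa> \<gamma> c) x k) k}"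
  let ?good = "\<lambda>n. {\<omega> \<in> space M. path_through (H \<omega>) (good_sets N (cutoff N \<kappa> \<gamma> c) v w n) n}"
  let ?D = "drop_const \<kappa> \<gamma> * e powr (-\<gamma>) * exp (- c * \<gamma>)"
  let ?Q = "\<kappa> * e powr (- 2 * \<gamma>) / real N * exp (2 * (1 - \<gamma>) * (c * growth \<gamma> ^ Suc m))"
  have D_nonneg: "0 \<le> ?D" and Q_nonneg: "0 \<le> ?Q"
    using kappa_nonneg gamma by (auto simp: drop_const_def)
  have union_le: "prob (\<Union>k\<in>{1..r}. {\<omega> \<in> space M. P k (H \<omega>)}) \<le> 2 * b"
    if "0 \<le> b" "\<And>k. k \<in> {1..r} \<Longrightarrow> prob {\<omega> \<in> space M. P k (H \<omega>)} \<le> b * (1/2) ^ (k - 1)" for P r b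
  proof -
    have "prob (\<Union>k\<in>{1..r}. {\<omega> \<in> space M. P k (H \<omega>)}) \<le> (\<Sum>k=1..r. prob {\<omega> \<in> space M. P k (H \<omega>)})"
      by (intro finite_measure_subadditive_finite) (auto intro: event_H)
    also have "\<dots> \<le> (\<Sum>k=1..r. b * (1/2) ^ (k - 1))" by (intro sum_mono that(2))
    also have "\<dots> = b * (\<Sum>k=1..r. (1/2) ^ (k - 1))" by (simp only: sum_distrib_left)
    also have "\<dots> \<le> b * 2" by (intro mult_left_mono sum_half_powers_le that(1))
    finally show ?thesis by simp
  qed
  have "{\<omega> \<in> space M. graph_dist (H \<omega>) v w < enat (2 * m + 2)}
      \<subseteq> ((\<Union>k\<in>{1..m}. ?drop v k) \<union> (\<Union>k\<in>{1..m}. ?drop w k)) \<union> (\<Union>n\<in>{1..2*m+1}. ?good n)"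
  proof
    fix \<omega> assume "\<omega> \<in> {\<omega> \<in> space M. graph_dist (H \<omega>) v w < enat (2 * m + 2)}"
    then have \<omega>: "\<omega> \<in> space M" and "graph_dist (H \<omega>) v w < enat (2 * m + 2)" by auto
    then obtain p n where p: "n < 2 * m + 2" "p 0 = v" "p n = w" "inj_on p {0..n}" "is_walk (H \<omega>) p n"
      by (elim graph_dist_less_obtains_path)
    have n: "n \<le> 2 * m + 1" using p(1) by simp
    have "n \<noteq> 0" using p \<open>v \<noteq> w\<close> by (cases n) auto
    then have "n \<in> {1..2*m+1}" using n by simp
    with path_good_or_drops[OF H_in_edge_sets[OF \<omega>] v(1) p(2-5) n, of "cutoff N \<kappa> \<gamma> c"] \<omega>
    show "\<omega> \<in> ((\<Union>k\<in>{1..m}. ?drop v k) \<union> (\<Union>k\<in>{1..m}. ?drop w k)) \<union> (\<Union>n\<in>{1..2*m+1}. ?good n)"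
      by blast
  qed
  then have "prob {\<omega> \<in> space M. graph_dist (H \<omega>) v w < enat (2 * m + 2)}
      \<le> prob (((\<Union>k\<in>{1..m}. ?drop v k) \<union> (\<Union>k\<in>{1..m}. ?drop w k)) \<union> (\<Union>n\<in>{1..2*m+1}. ?good n))"
    by (intro finite_measure_mono sets.Un sets.finite_UN event_H) auto
  also have "\<dots> \<le> prob ((\<Union>k\<in>{1..m}. ?drop v k) \<union> (\<Union>k\<in>{1..m}. ?drop w k)) + prob (\<Union>n\<in>{1..2*m+1}. ?good n)"
    by (intro measure_Un_le sets.Un sets.finite_UN event_H) auto
  also have "\<dots> \<le> prob (\<Union>k\<in>{1..m}. ?drop v k) + prob (\<Union>k\<in>{1..m}. ?drop w k) + prob (\<Union>n\<in>{1..2*m+1}. ?good n)"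
    by (intro add_right_mono measure_Un_le sets.finite_UN event_H) auto
  also have "\<dots> \<le> 2 * ?D + 2 * ?D + 2 * ?Q"
  proof (intro add_mono union_le D_nonneg Q_nonneg)
    fix k assume "k \<in> {1..m}"
    then show "prob (?drop v k) \<le> ?D * (1/2) ^ (k - 1)" "prob (?drop w k) \<le> ?D * (1/2) ^ (k - 1)"
      using prob_drop_le[of k v e c] prob_drop_le[of k w e c] v w assms(2) by simp_all
  next
    fix n assume "n \<in> {1..2*m+1}"
    then show "prob (?good n) \<le> ?Q * (1/2) ^ (n - 1)"
      using assms by (intro prob_good_le) auto
  qed
  finally show ?thesis by simp
qed

section \<open>Random end vertices\<close>

text \<open>
  Conditioning on the values of the two vertices, carried out as a finite decomposition of the
  event. Measurability comes from the same decomposition, so it holds for every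
  predicate \<open>P\<close> on edge sets and vertices.
\<close>

lemma independent_uniform_pair:
  assumes X: "distr M (count_space {1..N}) X = uniform_count_measure {1..N}"
    and Y: "distr M (count_space {1..N}) Y = uniform_count_measure {1..N}"
    and XY: "indep_var (count_space {1..N}) X (count_space {1..N}) Y"
    and HXY: "indep_set (sets (vimage_algebra (space M) H (count_space (edge_sets N))))
          (sets (vimage_algebra (space M) (\<lambda>\<omega>. (X \<omega>, Y \<omega>)) (count_space ({1..N} \<times> {1..N}))))"
  shows "{\<omega> \<in> space M. P (H \<omega>) (X \<omega>) (Y \<omega>)} \<in> events"
    and "prob {\<omega> \<in> space M. P (H \<omega>) (X \<omega>) (Y \<omega>)}
      \<le> (\<Sum>(v, w)\<in>{1..N} \<times> {1..N}. prob {\<omega> \<in> space M. P (H \<omega>) v w}) / (real N)\<^sup>2"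
proof -
  have meas_X: "X \<in> M \<rightarrow>\<^sub>M count_space {1..N}" and meas_Y: "Y \<in> M \<rightarrow>\<^sub>M count_space {1..N}"
    using indep_var_rv1[OF XY] indep_var_rv2[OF XY] by auto
  have range: "X \<omega> \<in> {1..N}" "Y \<omega> \<in> {1..N}" if "\<omega> \<in> space M" for \<omega>
    using measurable_space[OF meas_X that] measurable_space[OF meas_Y that] by auto
  have point: "prob (X -` {v} \<inter> space M) = 1 / real N" "prob (Y -` {v} \<inter> space M) = 1 / real N"
    if "v \<in> {1..N}" for v
  proof -
    have "measure (uniform_count_measure {1..N}) {v} = 1 / real N"
      using that by (subst measure_uniform_count_measure) auto
    with X Y that measure_distr[OF meas_X, of "{v}"] measure_distr[OF meas_Y, of "{v}"]
    show "prob (X -` {v} \<inter> space M) = 1 / real N" "prob (Y -` {v} \<inter> space M) = 1 / real N"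
      by auto
  qed
  define at_pair where "at_pair v w = (\<lambda>\<omega>. (X \<omega>, Y \<omega>)) -` ({v} \<times> {w}) \<inter> space M" for v w
  have at_sets: "at_pair v w \<in> sets (vimage_algebra (space M) (\<lambda>\<omega>. (X \<omega>, Y \<omega>)) (count_space ({1..N} \<times> {1..N})))"
    if "v \<in> {1..N}" "w \<in> {1..N}" for v w
    unfolding at_pair_def using that by (intro in_vimage_algebra) auto
  have at_event: "at_pair v w \<in> events" if "v \<in> {1..N}" "w \<in> {1..N}" for v w
    using indep_setD_ev2[OF HXY] at_sets[OF that] by auto
  have prob_at: "prob (at_pair v w) = 1 / (real N)\<^sup>2" if "v \<in> {1..N}" "w \<in> {1..N}" for v w
    using indep_varD[OF XY, of "{v}" "{w}"] point that unfolding at_pair_def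
    by (simp add: power2_eq_square)
  have prob_joint: "prob ({\<omega> \<in> space M. P (H \<omega>) v w} \<inter> at_pair v w)
      = prob {\<omega> \<in> space M. P (H \<omega>) v w} / (real N)\<^sup>2" if vw: "v \<in> {1..N}" "w \<in> {1..N}" for v w
  proof -
    have "H -` {E \<in> edge_sets N. P E v w} \<inter> space M
        \<in> sets (vimage_algebra (space M) H (count_space (edge_sets N)))"
      by (intro in_vimage_algebra) auto
    also have "H -` {E \<in> edge_sets N. P E v w} \<inter> space M = {\<omega> \<in> space M. P (H \<omega>) v w}"
      using H_in_edge_sets by auto
    finally show ?thesis using indep_setD[OF HXY _ at_sets[OF vw]] prob_at[OF vw] by simp
  qed
  have split: "{\<omega> \<in> space M. P (H \<omega>) (X \<omega>) (Y \<omega>)}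
      = (\<Union>(v, w)\<in>{1..N} \<times> {1..N}. {\<omega> \<in> space M. P (H \<omega>) v w} \<inter> at_pair v w)"
    using range by (auto simp: at_pair_def)
  have pieces: "{\<omega> \<in> space M. P (H \<omega>) (fst q) (snd q)} \<inter> at_pair (fst q) (snd q) \<in> events"
    if "q \<in> {1..N} \<times> {1..N}" for q
    using that by (intro sets.Int event_H at_event) auto
  show "{\<omega> \<in> space M. P (H \<omega>) (X \<omega>) (Y \<omega>)} \<in> events"
    unfolding split case_prod_beta by (intro sets.finite_UN pieces) auto
  have "prob {\<omega> \<in> space M. P (H \<omega>) (X \<omega>) (Y \<omega>)}
      \<le> (\<Sum>q\<in>{1..N} \<times> {1..N}. prob ({\<omega> \<in> space M. P (H \<omega>) (fst q) (snd q)} \<inter> at_pair (fst q) (snd q)))"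
    unfolding split case_prod_beta using pieces by (intro finite_measure_subadditive_finite) auto
  also have "\<dots> = (\<Sum>q\<in>{1..N} \<times> {1..N}. prob {\<omega> \<in> space M. P (H \<omega>) (fst q) (snd q)} / (real N)\<^sup>2)"
    by (intro sum.cong prob_joint) auto
  finally show "prob {\<omega> \<in> space M. P (H \<omega>) (X \<omega>) (Y \<omega>)}
      \<le> (\<Sum>(v, w)\<in>{1..N} \<times> {1..N}. prob {\<omega> \<in> space M. P (H \<omega>) v w}) / (real N)\<^sup>2"
    by (simp add: case_prod_beta sum_divide_distrib)
qed

end

lemma card_below_le:
  assumes "0 \<le> x"
  shows "real (card {v \<in> {1..N}. real v < x}) \<le> x"
proof -
  have "card {v \<in> {1..N}. real v < x} \<le> card {1..nat \<lfloor>x\<rfloor>}"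
    by (intro card_mono) (auto simp: le_nat_floor)
  then have "real (card {v \<in> {1..N}. real v < x}) \<le> real (nat \<lfloor>x\<rfloor>)" by simp
  also have "\<dots> \<le> x" using assms by simp
  finally show ?thesis .
qed

text \<open>
  The exceptional pairs are those with an endpoint below \<open>e * N\<close>, a fraction of at most \<open>2 * e\<close>, and the
  \<open>N\<close> diagonal ones.
\<close>

lemma average_over_pairs_le:
  fixes f :: "nat \<Rightarrow> nat \<Rightarrow> real"
  assumes "1 \<le> N" "0 \<le> e" "0 \<le> q" and f_le_1: "\<And>v w. f v w \<le> 1"
    and f_le: "\<And>v w. v \<in> {1..N} \<Longrightarrow> w \<in> {1..N} \<Longrightarrow> v \<noteq> w \<Longrightarrow> e * real N \<le> real v \<Longrightarrow>
      e * real N \<le> real w \<Longrightarrow> f v w \<le> q"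
  shows "(\<Sum>(v, w)\<in>{1..N} \<times> {1..N}. f v w) / (real N)\<^sup>2 \<le> q + 2 * e + 1 / real N"
proof -
  let ?low = "\<lambda>v. if real v < e * real N then 1 else (0::real)"
  have low_sum: "(\<Sum>v=1..N. ?low v) \<le> e * real N"
    using card_below_le[of "e * real N" N] assms(2)
    by (simp add: sum.If_cases Int_def conj_commute)
  have "(\<Sum>(v, w)\<in>{1..N} \<times> {1..N}. f v w)
      \<le> (\<Sum>(v, w)\<in>{1..N} \<times> {1..N}. q + ?low v + ?low w + (if v = w then 1 else 0))"
    using f_le f_le_1 assms(3) by (intro sum_mono) (fastforce intro: order_trans[OF f_le_1])
  also have "\<dots> = (real N)\<^sup>2 * q + 2 * (real N * (\<Sum>v=1..N. ?low v)) + real N"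
    by (simp add: sum.cartesian_product[symmetric] sum.distrib sum.delta power2_eq_square
        sum_distrib_left algebra_simps)
  also have "\<dots> \<le> (real N)\<^sup>2 * q + 2 * (real N * (e * real N)) + real N"
    using low_sum by (intro add_mono mult_left_mono) auto
  also have "\<dots> = (real N)\<^sup>2 * (q + 2 * e + 1 / real N)"
    using assms(1) by (simp add: power2_eq_square field_simps)
  finally show ?thesis using assms(1) by (simp add: field_simps)
qed

section \<open>The lower bound for typical distances\<close>

text \<open>
  The constant is automatically nonnegative: for \<open>N = 2\<close> it bounds the probability of the edge
  between the vertices 1 and 2, up to a positive factor.
\<close>

lemma assumption_CM_obtains_nonneg_const:
  assumes "assumption_CM M G \<gamma>"
  obtains \<kappa> where "0 \<le> \<kappa>" "\<And>N l v. 1 \<le> N \<Longrightarrow> inj_on v {0..l} \<Longrightarrow> v ` {0..l} \<subseteq> {1..N} \<Longrightarrow>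
        measure M {\<omega> \<in> space M. is_walk (G N \<omega>) v l}
          \<le> (\<Prod>k=1..l. \<kappa> * real (v (k - 1)) powr (-\<gamma>) * real (v k) powr (-\<gamma>)
                           * real N powr (2 * \<gamma> - 1))"
proof -
  obtain \<kappa> where \<kappa>: "\<And>N l v. 1 \<le> N \<Longrightarrow> inj_on v {0..l} \<Longrightarrow> v ` {0..l} \<subseteq> {1..N} \<Longrightarrow>
        measure M {\<omega> \<in> space M. is_walk (G N \<omega>) v l}
          \<le> (\<Prod>k=1..l. \<kappa> * real (v (k - 1)) powr (-\<gamma>) * real (v k) powr (-\<gamma>)
                           * real N powr (2 * \<gamma> - 1))"
    using assms unfolding assumption_CM_def by blast
  have "0 \<le> \<kappa> * (2 powr (-\<gamma>) * 2 powr (2 * \<gamma> - 1))"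
    using order_trans[OF measure_nonneg \<kappa>[of 2 Suc 1]] by (simp add: mult.assoc)
  moreover have "0 < 2 powr (-\<gamma>) * 2 powr (2 * \<gamma> - 1)" by simp
  ultimately have "0 \<le> \<kappa>" unfolding zero_le_mult_iff by linarith
  with \<kappa> that show ?thesis by blast
qed

theorem theorem2:
  fixes M :: "'a measure"
    and G :: "nat \<Rightarrow> 'a \<Rightarrow> (nat \<times> nat) set"
    and V W :: "nat \<Rightarrow> 'a \<Rightarrow> nat"
    and \<gamma> :: real
  assumes "network_model M G"
    and "1/2 < \<gamma>" and "\<gamma> < 1"
    and "assumption_CM M G \<gamma>"
    and "independent_uniform_vertices M G V W"
  shows "whp_ge_plus_O1 M
           (\<lambda>N \<omega>. ereal_of_enat (graph_dist (G N \<omega>) (V N \<omega>) (W N \<omega>)))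
           (\<lambda>N. 2 * (ln (ln (real N)) / ln (\<gamma> / (1 - \<gamma>))))"
  unfolding whp_ge_plus_O1_def
proof (intro allI impI)
  fix \<epsilon> :: real assume \<epsilon>: "0 < \<epsilon>"
  obtain \<kappa> where \<kappa>: "0 \<le> \<kappa>" and CM: "\<And>N l v. 1 \<le> N \<Longrightarrow> inj_on v {0..l} \<Longrightarrow> v ` {0..l} \<subseteq> {1..N} \<Longrightarrow>
        measure M {\<omega> \<in> space M. is_walk (G N \<omega>) v l}
          \<le> (\<Prod>k=1..l. \<kappa> * real (v (k - 1)) powr (-\<gamma>) * real (v k) powr (-\<gamma>)
                           * real N powr (2 * \<gamma> - 1))"
    using assumption_CM_obtains_nonneg_const[OF assms(4)] by blast
  let ?\<rho> = "growth \<gamma>"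
  have \<rho>: "1 < ?\<rho>" by (rule growth_gt_1) fact+
  \<comment> \<open>The failure probability splits into \<open>2 * e = \<epsilon> / 4\<close> for atypical end vertices, at most \<open>\<epsilon> / 4\<close>
      for drops, and a remainder that tends to 0 as \<open>N\<close> grows.\<close>
  define e where "e = \<epsilon> / 8"
  define D where "D = 4 * drop_const \<kappa> \<gamma> * e powr (-\<gamma>)"
  have D: "0 \<le> D" using \<kappa> assms(3) by (simp add: D_def drop_const_def)
  \<comment> \<open>Any \<open>c\<close> large enough for \<open>exp (- c * \<gamma>)\<close> to absorb the constant; this value works by
      \<open>x \<le> exp x\<close>.\<close>
  define c where "c = max 1 (4 * D / (\<epsilon> * \<gamma>))"
  have c: "1 \<le> c" and "4 * D / (\<epsilon> * \<gamma>) \<le> c" by (auto simp: c_def)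
  then have "4 * D \<le> \<epsilon> * (c * \<gamma>)" using \<epsilon> assms(2) by (simp add: field_simps)
  also have "\<dots> \<le> \<epsilon> * exp (c * \<gamma>)"
    using exp_ge_add_one_self[of "c * \<gamma>"] \<epsilon> by (intro mult_left_mono) linarith+
  finally have drop_small: "D * exp (- c * \<gamma>) \<le> \<epsilon> / 4"
    by (simp add: exp_minus field_simps)
  \<comment> \<open>With \<open>L = ln (ln N) / ln (growth \<gamma>)\<close> one has \<open>growth \<gamma> powr L = ln N\<close>. Lowering \<open>L\<close> by \<open>C / 2 - 1\<close>
      divides this by \<open>c\<close>; the summand 2 compensates for the exponent \<open>Suc m\<close> below.\<close>
  define C where "C = 2 + 2 * (ln c / ln ?\<rho>)"
  have ev: "\<forall>\<^sub>F N in sequentially. C / 2 \<le> ln (ln (real N)) / ln ?\<rho>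
      \<and> 1 / real N + 2 * \<kappa> * e powr (- 2 * \<gamma>) * real N powr (1 - 2 * \<gamma>) < \<epsilon> / 4"
  proof (intro eventually_conj)
    have "filterlim (\<lambda>N. ln (ln (real N)) / ln ?\<rho>) at_top sequentially"
      by (rule filterlim_at_top_mult_tendsto_pos[of "\<lambda>_. 1 / ln ?\<rho>" "1 / ln ?\<rho>", simplified])
         (use \<rho> in \<open>auto intro!: filterlim_compose[OF ln_at_top] filterlim_real_sequentially\<close>)
    then show "\<forall>\<^sub>F N in sequentially. C / 2 \<le> ln (ln (real N)) / ln ?\<rho>"
      unfolding filterlim_at_top by (rule spec)
    have "(\<lambda>N. real N powr (1 - 2 * \<gamma>)) \<longlonglongrightarrow> 0"
      using assms(2) by (intro tendsto_neg_powr filterlim_real_sequentially) simp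
    then have "(\<lambda>N. 1 / real N + 2 * \<kappa> * e powr (- 2 * \<gamma>) * real N powr (1 - 2 * \<gamma>))
        \<longlonglongrightarrow> 0 + 2 * \<kappa> * e powr (- 2 * \<gamma>) * 0"
      by (intro tendsto_intros lim_1_over_n)
    then show "\<forall>\<^sub>F N in sequentially.
        1 / real N + 2 * \<kappa> * e powr (- 2 * \<gamma>) * real N powr (1 - 2 * \<gamma>) < \<epsilon> / 4"
      using \<epsilon> by (intro order_tendstoD(2)) auto
  qed
  have "\<forall>\<^sub>F N in sequentially. measure M {\<omega> \<in> space M.
      ereal_of_enat (graph_dist (G N \<omega>) (V N \<omega>) (W N \<omega>))
        \<ge> ereal (2 * (ln (ln (real N)) / ln (\<gamma> / (1 - \<gamma>))) - C)} \<ge> 1 - \<epsilon>"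
    using ev eventually_ge_at_top[of 3]
  proof eventually_elim
    case (elim N)
    then have N: "3 \<le> N" by simp
    define L where "L = ln (ln (real N)) / ln ?\<rho>"
    have L: "C / 2 \<le> L" using elim by (simp add: L_def)
    interpret prob_space M using assms(1) by (simp add: network_model_def)
    interpret cm_random_graph M "G N" N \<kappa> \<gamma>
      using assms(1-3) \<kappa> CM N by unfold_locales (auto simp: network_model_def)
    note pair = independent_uniform_pair[of "V N" "W N"]
    have indep: "distr M (count_space {1..N}) (V N) = uniform_count_measure {1..N}"
      "distr M (count_space {1..N}) (W N) = uniform_count_measure {1..N}"
      "indep_var (count_space {1..N}) (V N) (count_space {1..N}) (W N)"
      "indep_set (sets (vimage_algebra (space M) (G N) (count_space (edge_sets N))))
          (sets (vimage_algebra (space M) (\<lambda>\<omega>. (V N \<omega>, W N \<omega>)) (count_space ({1..N} \<times> {1..N}))))"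
      using assms(5) N by (auto simp: independent_uniform_vertices_def)
    define m where "m = nat \<lfloor>L - C / 2\<rfloor>"
    have m: "real m \<le> L - C / 2" "L - C / 2 < real m + 1"
      using L by (auto simp: m_def)
    have ln_N: "0 < ln (real N)" using N by simp
    have "?\<rho> ^ Suc m = ?\<rho> powr (real m + 1)"
      using \<rho> by (simp add: powr_add powr_realpow)
    also have "\<dots> \<le> ?\<rho> powr (L - ln c / ln ?\<rho>)"
      using \<rho> m(1) by (intro powr_mono) (auto simp: C_def add_divide_distrib)
    also have "\<dots> = ln (real N) / c"
      using \<rho> ln_N c by (simp add: powr_def L_def algebra_simps exp_diff)
    finally have reach: "c * ?\<rho> ^ Suc m \<le> ln (real N)"
      using c by (simp add: field_simps)
    define q where "q = D * exp (- c * \<gamma>) + 2 * \<kappa> * e powr (- 2 * \<gamma>) * real N powr (1 - 2 * \<gamma>)"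
    have q_nonneg: "0 \<le> q" using D \<kappa> by (simp add: q_def)
    have dist_le: "prob {\<omega> \<in> space M. graph_dist (G N \<omega>) v w < enat (2 * m + 2)} \<le> q"
      if "v \<in> {1..N}" "w \<in> {1..N}" "v \<noteq> w" "e * real N \<le> real v" "e * real N \<le> real w" for v w
    proof -
      have "exp (2 * (1 - \<gamma>) * (c * ?\<rho> ^ Suc m)) \<le> exp (2 * (1 - \<gamma>) * ln (real N))"
        using reach assms(3) by (subst exp_le_cancel_iff, intro mult_left_mono) auto
      also have "\<dots> = real N powr (2 - 2 * \<gamma>)" using N by (simp add: powr_def algebra_simps)
      finally have growth_le: "exp (2 * (1 - \<gamma>) * (c * ?\<rho> ^ Suc m)) \<le> real N powr (2 - 2 * \<gamma>)" .
      have "prob {\<omega> \<in> space M. graph_dist (G N \<omega>) v w < enat (2 * m + 2)}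
          \<le> D * exp (- c * \<gamma>)
            + 2 * \<kappa> * e powr (- 2 * \<gamma>) / real N * exp (2 * (1 - \<gamma>) * (c * ?\<rho> ^ Suc m))"
        unfolding D_def using that c \<epsilon> by (intro prob_dist_less_le) (auto simp: e_def)
      also have "\<dots> \<le> D * exp (- c * \<gamma>)
            + 2 * \<kappa> * e powr (- 2 * \<gamma>) / real N * real N powr (2 - 2 * \<gamma>)"
        using growth_le \<kappa> by (intro add_left_mono mult_left_mono) auto
      also have "real N powr (2 - 2 * \<gamma>) = real N * real N powr (1 - 2 * \<gamma>)"
        using N powr_add[of "real N" 1 "1 - 2 * \<gamma>"] by simp
      finally show ?thesis using N by (simp add: q_def)
    qed
    have "prob {\<omega> \<in> space M. graph_dist (G N \<omega>) (V N \<omega>) (W N \<omega>) < enat (2 * m + 2)}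
        \<le> (\<Sum>(v, w)\<in>{1..N} \<times> {1..N}.
            prob {\<omega> \<in> space M. graph_dist (G N \<omega>) v w < enat (2 * m + 2)}) / (real N)\<^sup>2"
      by (rule pair(2)[OF indep, of "\<lambda>E v w. graph_dist E v w < enat (2 * m + 2)"])
    also have "\<dots> \<le> q + 2 * e + 1 / real N"
      using N \<epsilon> q_nonneg dist_le by (intro average_over_pairs_le) (auto simp: e_def)
    also have "\<dots> \<le> \<epsilon>"
      using elim(1) drop_small \<epsilon> by (simp add: q_def e_def)
    finally have short: "prob {\<omega> \<in> space M. graph_dist (G N \<omega>) (V N \<omega>) (W N \<omega>) < enat (2 * m + 2)} \<le> \<epsilon>" .
    let ?long = "{\<omega> \<in> space M. \<not> graph_dist (G N \<omega>) (V N \<omega>) (W N \<omega>) < enat (2 * m + 2)}"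
    have "1 - \<epsilon> \<le> prob ?long"
      using short pair(1)[OF indep, of "\<lambda>E v w. graph_dist E v w < enat (2 * m + 2)"]
      by (simp add: prob_neg)
    also have "\<dots> \<le> prob {\<omega> \<in> space M.
      ereal_of_enat (graph_dist (G N \<omega>) (V N \<omega>) (W N \<omega>))
        \<ge> ereal (2 * (ln (ln (real N)) / ln (\<gamma> / (1 - \<gamma>))) - C)}"
    proof (intro finite_measure_mono)
      have bound: "ereal (2 * (ln (ln (real N)) / ln (\<gamma> / (1 - \<gamma>))) - C) \<le> ereal_of_enat (enat (2 * m + 2))"
        using m(2) by (simp add: L_def growth_def)
      show "?long \<subseteq> {\<omega> \<in> space M. ereal_of_enat (graph_dist (G N \<omega>) (V N \<omega>) (W N \<omega>))
        \<ge> ereal (2 * (ln (ln (real N)) / ln (\<gamma> / (1 - \<gamma>))) - C)}"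
      proof safe
        fix \<omega> assume "\<not> graph_dist (G N \<omega>) (V N \<omega>) (W N \<omega>) < enat (2 * m + 2)"
        then have "ereal_of_enat (enat (2 * m + 2))
            \<le> ereal_of_enat (graph_dist (G N \<omega>) (V N \<omega>) (W N \<omega>))"
          by (simp only: ereal_of_enat_le_iff not_less)
        with bound show "ereal (2 * (ln (ln (real N)) / ln (\<gamma> / (1 - \<gamma>))) - C)
            \<le> ereal_of_enat (graph_dist (G N \<omega>) (V N \<omega>) (W N \<omega>))"
          by (rule order_trans)
      qed
      show "{\<omega> \<in> space M. ereal_of_enat (graph_dist (G N \<omega>) (V N \<omega>) (W N \<omega>))
        \<ge> ereal (2 * (ln (ln (real N)) / ln (\<gamma> / (1 - \<gamma>))) - C)} \<in> events"
        by (rule pair(1)[OF indep])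
    qed
    finally show ?case .
  qed
  then show "\<exists>C. \<forall>\<^sub>F N in sequentially. measure M {\<omega> \<in> space M.
      ereal_of_enat (graph_dist (G N \<omega>) (V N \<omega>) (W N \<omega>))
        \<ge> ereal (2 * (ln (ln (real N)) / ln (\<gamma> / (1 - \<gamma>))) - C)} \<ge> 1 - \<epsilon>" ..
qed

end
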